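(* Let $\nu>0$ and $\lambda\neq0$. Suppose that the initial data is $\mu=\delta_0'$, the (distributional) derivative of the Dirac delta measure at zero. Then the parabolic Anderson model $\left(\partial_t-\frac{\nu}{2}\partial_x^2\right)u=\lambda u\,\dot W$ on $\mathbb{R}_+^*\times\mathbb{R}$, $u(0,\cdot)=\mu$, does not have a random field solution.
   Context: $\mathbb{R}_+^*=\,]0,+\infty[$. $G_\nu(t,x)=\frac{1}{\sqrt{2\pi\nu t}}\exp\{-\frac{|x|^2}{2\nu t}\}$ for $t>0$, and $G_\nu(t,\cdot)\equiv0$ for $t\le 0$. $\dot W$ is a space-time white noise on $\mathbb{R}_+\times\mathbb{R}$ defined on a probability space $(\Omega,\mathcal F,P)$, with $(\mathcal F_t)$ its natural filtration augmented by the $P$-null sets and made right-continuous. Stochastic integrals are in the sense of Walsh. $\|\cdot\|_2$ is the $L^2(\Omega)$-norm, and $(f\star g)(t,x)=\int_0^t\mathrm{d}s\int_{\mathbb{R}}f(s,y)g(t-s,x-y)\,\mathrm{d}y$. Put $J_0(t,x)=(\mu*G_\nu(t,\cdot))(x)$, which for $\mu=\delta_0'$ equals $\partial_xG_\nu(t,x)$; let $\rho(u)=\lambda u$ and $I(t,x)=\iint_{[0,t]\times\mathbb{R}}G_\nu(t-s,x-y)\rho(u(s,y))\dot W(\mathrm{d}s,\mathrm{d}y)$. A random field solution is $u=(u(t,x):(t,x)\in\mathbb{R}_+^*\times\mathbb{R})$ such that: (a) $u(t,x)$ is $\mathcal F_t$-measurable for all $(t,x)$; (b) $u$ is jointly measurable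 with respect to $\mathcal B(\mathbb{R}_+^*\times\mathbb{R})\times\mathcal F$; (c) $(G_\nu^2\star\|\rho(u)\|_2^2)(t,x)<+\infty$ for all $(t,x)\in\mathbb{R}_+^*\times\mathbb{R}$, and $(t,x)\mapsto I(t,x)$ is continuous from $\mathbb{R}_+^*\times\mathbb{R}$ into $L^2(\Omega)$; (d) for all $(t,x)\in\mathbb{R}_+^*\times\mathbb{R}$, $u(t,x)=J_0(t,x)+I(t,x)$ almost surely. *)

theory Defs
  imports "HOL-Probability.Probability"
begin

section \<open>Space-time white noise and its filtration\<close>

text \<open>Degenerate (almost surely constant) variables count as Gaussian, as usual for Gaussian
  processes.\<close>

definition gaussian_rv :: "'w measure \<Rightarrow> ('w \<Rightarrow> real) \<Rightarrow> bool" where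
  "gaussian_rv M X \<longleftrightarrow> X \<in> borel_measurable M \<and>
     ((\<exists>m. AE w in M. X w = m) \<or>
      (\<exists>m s. s > 0 \<and> distributed M lborel X (\<lambda>x. ennreal (normal_density m s x))))"

definition noise_sets :: "(real \<times> real) set set" where
  "noise_sets = {A \<in> sets borel. A \<subseteq> {0..} \<times> UNIV \<and> emeasure lborel A < \<infinity>}"

text \<open>White noise on \<open>[0,\<infinity>) \<times> \<real>\<close>: a centred Gaussian process indexed by the Borel sets of finite
  Lebesgue measure, with covariance \<open>E[W(A) W(B)] = |A \<inter> B|\<close>.\<close>

definition space_time_white_noise ::
    "'w measure \<Rightarrow> ((real \<times> real) set \<Rightarrow> 'w \<Rightarrow> real) \<Rightarrow> bool" where
  "space_time_white_noise M W \<longleftrightarrow>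
     (\<forall>F c. finite F \<and> F \<subseteq> noise_sets \<longrightarrow> gaussian_rv M (\<lambda>w. \<Sum>A\<in>F. c A * W A w)) \<and>
     (\<forall>A\<in>noise_sets. W A \<in> borel_measurable M) \<and>
     (\<forall>A\<in>noise_sets. (LINT w|M. W A w) = 0) \<and>
     (\<forall>A\<in>noise_sets. \<forall>B\<in>noise_sets. (LINT w|M. W A w * W B w) = measure lborel (A \<inter> B))"

definition finite_borel :: "real set set" where
  "finite_borel = {A \<in> sets borel. emeasure lborel A < \<infinity>}"

text \<open>The martingale measure \<open>W\<^sub>t(A) = W([0,t] \<times> A)\<close>.\<close>

definition mart_measure ::
    "((real \<times> real) set \<Rightarrow> 'w \<Rightarrow> real) \<Rightarrow> real \<Rightarrow> real set \<Rightarrow> 'w \<Rightarrow> real" where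
  "mart_measure W t A = W ({0..t} \<times> A)"

definition augmented_natural_filtration ::
    "'w measure \<Rightarrow> ((real \<times> real) set \<Rightarrow> 'w \<Rightarrow> real) \<Rightarrow> real \<Rightarrow> 'w measure" where
  "augmented_natural_filtration M W t = sigma (space M)
     (null_sets M \<union>
      {mart_measure W s A -` B \<inter> space M | s A B.
         0 \<le> s \<and> s \<le> t \<and> A \<in> finite_borel \<and> B \<in> sets borel})"

definition noise_filtration ::
    "'w measure \<Rightarrow> ((real \<times> real) set \<Rightarrow> 'w \<Rightarrow> real) \<Rightarrow> real \<Rightarrow> 'w measure" where
  "noise_filtration M W t =
     sigma (space M) (\<Inter>s\<in>{t<..}. sets (augmented_natural_filtration M W s))"

lemma space_augmented_natural_filtration [simp]:
  "space (augmented_natural_filtration M W t) = space M"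
  unfolding augmented_natural_filtration_def by (rule space_measure_of_conv)

lemma space_noise_filtration [simp]: "space (noise_filtration M W t) = space M"
  unfolding noise_filtration_def by (rule space_measure_of_conv)

lemma sets_noise_filtration:
  "sets (noise_filtration M W t) = (\<Inter>s\<in>{t<..}. sets (augmented_natural_filtration M W s))"
proof -
  let ?F = "\<lambda>s. sets (augmented_natural_filtration M W s)"
  have sub: "A \<subseteq> space M" if "A \<in> ?F s" for A s
    using sets.sets_into_space[OF that] by simp
  have compl: "space M - A \<in> ?F s" if "A \<in> ?F s" for A s
    using sets.compl_sets[OF that] by simp
  have "sigma_algebra (space M) (\<Inter>(?F ` {t<..}))"
    unfolding sigma_algebra_iff2
  proof (intro conjI)
    show "\<Inter>(?F ` {t<..}) \<subseteq> Pow (space M)"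
      using sub[of _ "t + 1"] by force
  qed (use compl in \<open>auto intro!: sets.countable_UN\<close>)
  then show ?thesis
    unfolding noise_filtration_def by (simp add: sigma_algebra.sets_measure_of_eq)
qed

section \<open>Second moments and the Walsh integral\<close>

text \<open>The square of the \<open>L\<^sup>2(\<Omega>)\<close>-norm, with value \<open>\<infinity>\<close> outside \<open>L\<^sup>2(\<Omega>)\<close>.\<close>

definition L2norm_sq :: "'w measure \<Rightarrow> ('w \<Rightarrow> real) \<Rightarrow> ennreal" where
  "L2norm_sq M X = (\<integral>\<^sup>+w. ennreal ((X w)\<^sup>2) \<partial>M)"

text \<open>\<open>(a, b, A, X)\<close> encodes the elementary process \<open>X(\<omega>) 1\<^bsub>(a,b]\<^esub>(s) 1\<^bsub>A\<^esub>(y)\<close>; a simple process is a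
  finite sum of these, encoded as a list.\<close>

type_synonym 'w elementary = "real \<times> real \<times> real set \<times> ('w \<Rightarrow> real)"

definition elementary_process ::
    "'w measure \<Rightarrow> ((real \<times> real) set \<Rightarrow> 'w \<Rightarrow> real) \<Rightarrow> 'w elementary \<Rightarrow> bool" where
  "elementary_process M W = (\<lambda>(a, b, A, X).
     0 \<le> a \<and> a < b \<and> A \<in> finite_borel \<and>
     X \<in> borel_measurable (noise_filtration M W a) \<and> (\<exists>C. \<forall>w\<in>space M. \<bar>X w\<bar> \<le> C))"

definition simple_process ::
    "'w measure \<Rightarrow> ((real \<times> real) set \<Rightarrow> 'w \<Rightarrow> real) \<Rightarrow> 'w elementary list \<Rightarrow> bool" where
  "simple_process M W S \<longleftrightarrow> (\<forall>e\<in>set S. elementary_process M W e)"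

definition simple_value :: "'w elementary list \<Rightarrow> real \<Rightarrow> real \<Rightarrow> 'w \<Rightarrow> real" where
  "simple_value S s y w =
     (\<Sum>(a, b, A, X)\<leftarrow>S. X w * indicator {a<..b} s * indicator A y)"

definition simple_integral ::
    "((real \<times> real) set \<Rightarrow> 'w \<Rightarrow> real) \<Rightarrow> 'w elementary list \<Rightarrow> 'w \<Rightarrow> real" where
  "simple_integral W S w =
     (\<Sum>(a, b, A, X)\<leftarrow>S. X w * (mart_measure W b A w - mart_measure W a A w))"

definition open_half_plane :: "(real \<times> real) set" where
  "open_half_plane = {0<..} \<times> UNIV"

text \<open>\<open>I\<close> is a version of \<open>\<integral>\<integral> X(s,y) W(ds,dy)\<close> over \<open>[0,\<infinity>) \<times> \<real>\<close>: Walsh's extension by the isometry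
  from simple processes to their closure in \<open>L\<^sup>2(ds dy dP)\<close>. The integral is determined only up to
  almost sure equality, hence a relation. The null slice \<open>s = 0\<close>, on which a random field on
  \<open>(0,\<infinity>) \<times> \<real>\<close> has no value, is left out.\<close>

definition has_walsh_integral ::
    "'w measure \<Rightarrow> ((real \<times> real) set \<Rightarrow> 'w \<Rightarrow> real) \<Rightarrow>
     (real \<Rightarrow> real \<Rightarrow> 'w \<Rightarrow> real) \<Rightarrow> ('w \<Rightarrow> real) \<Rightarrow> bool" where
  "has_walsh_integral M W X I \<longleftrightarrow>
     (\<lambda>((s, y), w). X s y w) \<in> borel_measurable (restrict_space borel open_half_plane \<Otimes>\<^sub>M M) \<and>
     I \<in> borel_measurable M \<and>
     (\<exists>S :: nat \<Rightarrow> 'w elementary list.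
        (\<forall>n. simple_process M W (S n)) \<and>
        (\<lambda>n. \<integral>\<^sup>+((s, y), w). ennreal ((simple_value (S n) s y w - X s y w)\<^sup>2)
               \<partial>(restrict_space lborel open_half_plane \<Otimes>\<^sub>M M)) \<longlonglongrightarrow> 0 \<and>
        (\<lambda>n. L2norm_sq M (\<lambda>w. simple_integral W (S n) w - I w)) \<longlonglongrightarrow> 0)"

section \<open>Heat kernel and distributional initial data\<close>

definition heat_kernel :: "real \<Rightarrow> real \<Rightarrow> real \<Rightarrow> real" where
  "heat_kernel nu t x =
     (if t > 0 then 1 / sqrt (2 * pi * nu * t) * exp (- (\<bar>x\<bar>\<^sup>2 / (2 * nu * t))) else 0)"

text \<open>Distributions are represented by their action on test functions.\<close>

type_synonym distribution = "(real \<Rightarrow> real) \<Rightarrow> real"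

definition dirac :: distribution where
  "dirac phi = phi 0"

definition distr_deriv :: "distribution \<Rightarrow> distribution" where
  "distr_deriv T = (\<lambda>phi. - T (deriv phi))"

definition distr_conv :: "distribution \<Rightarrow> (real \<Rightarrow> real) \<Rightarrow> real \<Rightarrow> real" where
  "distr_conv T g x = T (\<lambda>y. g (x - y))"

definition J0 :: "real \<Rightarrow> distribution \<Rightarrow> real \<Rightarrow> real \<Rightarrow> real" where
  "J0 nu mu t x = distr_conv mu (heat_kernel nu t) x"

lemma heat_kernel_has_derivative:
  assumes "nu > 0" "t > 0"
  shows "(heat_kernel nu t has_real_derivative - (x / (nu * t)) * heat_kernel nu t x) (at x)"
proof -
  have "((\<lambda>x. 1 / sqrt (2 * pi * nu * t) * exp (- (x\<^sup>2 / (2 * nu * t)))) has_real_derivative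
      - (x / (nu * t)) * (1 / sqrt (2 * pi * nu * t) * exp (- (x\<^sup>2 / (2 * nu * t))))) (at x)"
    using assms by (auto intro!: derivative_eq_intros simp: field_simps)
  then show ?thesis
    using assms by (simp add: heat_kernel_def[abs_def])
qed

lemma J0_deriv_dirac:
  assumes "nu > 0" "t > 0"
  shows "J0 nu (distr_deriv dirac) t x = deriv (heat_kernel nu t) x"
proof -
  let ?D = "- (x / (nu * t)) * heat_kernel nu t x"
  have D: "(heat_kernel nu t has_real_derivative ?D) (at (x - 0))"
    using heat_kernel_has_derivative[OF assms, of x] by simp
  have "((\<lambda>y. x - y) has_real_derivative -1) (at 0)"
    by (auto intro!: derivative_eq_intros)
  from DERIV_chain2[OF D this]
  have "deriv (\<lambda>y. heat_kernel nu t (x - y)) 0 = - ?D"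
    by (intro DERIV_imp_deriv) simp
  moreover have "deriv (heat_kernel nu t) x = ?D"
    using heat_kernel_has_derivative[OF assms] by (rule DERIV_imp_deriv)
  ultimately show ?thesis
    by (simp add: J0_def distr_conv_def distr_deriv_def dirac_def)
qed

section \<open>Random field solutions\<close>

definition spacetime_conv ::
    "(real \<Rightarrow> real \<Rightarrow> ennreal) \<Rightarrow> (real \<Rightarrow> real \<Rightarrow> ennreal) \<Rightarrow> real \<Rightarrow> real \<Rightarrow> ennreal" where
  "spacetime_conv f g t x =
     (\<integral>\<^sup>+s\<in>{0..t}. (\<integral>\<^sup>+y. f s y * g (t - s) (x - y) \<partial>lborel) \<partial>lborel)"

text \<open>The random field \<open>u\<close> and the stochastic convolution \<open>I\<close> are indexed by \<open>(0,\<infinity>) \<times> \<real>\<close>; their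
  values at other arguments are irrelevant. The field \<open>I\<close> is unique up to modification.\<close>

definition random_field_solution ::
    "'w measure \<Rightarrow> ((real \<times> real) set \<Rightarrow> 'w \<Rightarrow> real) \<Rightarrow> real \<Rightarrow> (real \<Rightarrow> real) \<Rightarrow> distribution \<Rightarrow>
     (real \<Rightarrow> real \<Rightarrow> 'w \<Rightarrow> real) \<Rightarrow> bool" where
  "random_field_solution M W nu rho mu u \<longleftrightarrow>
     (\<forall>t>0. \<forall>x. u t x \<in> borel_measurable (noise_filtration M W t)) \<and>
     (\<lambda>((t, x), w). u t x w) \<in> borel_measurable (restrict_space borel open_half_plane \<Otimes>\<^sub>M M) \<and>
     (\<forall>t>0. \<forall>x. spacetime_conv (\<lambda>s y. ennreal ((heat_kernel nu s y)\<^sup>2))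
                  (\<lambda>s y. L2norm_sq M (\<lambda>w. rho (u s y w))) t x < \<infinity>) \<and>
     (\<exists>I :: real \<Rightarrow> real \<Rightarrow> 'w \<Rightarrow> real.
        (\<forall>t>0. \<forall>x. has_walsh_integral M W
           (\<lambda>s y w. indicator {0..t} s * heat_kernel nu (t - s) (x - y) * rho (u s y w)) (I t x)) \<and>
        (\<forall>t>0. \<forall>x. L2norm_sq M (I t x) < \<infinity>) \<and>
        (\<forall>t>0. \<forall>x. ((\<lambda>(t', x'). L2norm_sq M (\<lambda>w. I t' x' w - I t x w)) \<longlongrightarrow> 0)
                      (at (t, x) within open_half_plane)) \<and>
        (\<forall>t>0. \<forall>x. AE w in M. u t x w = J0 nu mu t x + I t x w))"

end

theory Submission
  imports Defs
begin

text \<open>The obstruction is that \<open>J\<^sub>0(s, \<cdot>)\<close> is too large in \<open>L\<^sup>2\<close> near time \<open>0\<close>. For the initial datum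
  \<open>\<delta>\<^sub>0'\<close> one has \<open>J\<^sub>0(s, y) = - (y / (\<nu> s)) G\<^sub>\<nu>(s, y)\<close>, whose square has a space integral of order
  \<open>s\<close> to the power \<open>- 3 / 2\<close>; this is not integrable at \<open>s = 0\<close>, so the convolution
  \<open>G\<^sub>\<nu>\<^sup>2 \<star> (\<lambda> J\<^sub>0)\<^sup>2\<close> is infinite (\<open>spacetime_conv_J0_deriv_dirac_infinite\<close>).

  The noise cannot cancel \<open>J\<^sub>0\<close>: a solution is \<open>u = J\<^sub>0 + I\<close> with a stochastic integral \<open>I\<close>, so
  \<open>E u = J\<^sub>0\<close> and \<open>E (\<lambda> u)\<^sup>2 \<ge> (\<lambda> J\<^sub>0)\<^sup>2\<close>. The integrability condition (c) therefore fails.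

  The probabilistic content is \<open>E I = 0\<close> (\<open>expectation_walsh_integral\<close>). It reduces to
  \<open>E (X (W\<^sub>b(A) - W\<^sub>a(A))) = 0\<close> for bounded \<open>X\<close> known at time \<open>a\<close> (\<open>expectation_mult_increment\<close>).
  The increment \<open>D\<close> is uncorrelated to the noise before time \<open>a\<close>, and all these variables are jointly
  Gaussian. From this the proof extracts \<open>E (D exp (i f)) = 0\<close> for every linear combination \<open>f\<close> of past
  noise values (\<open>orthogonal_exp_of_uncorrelated_gaussian\<close>) and transfers it to past events by applying
  Levy's one-dimensional uniqueness theorem one generating event at a time
  (\<open>orthogonal_sigma_of_orthogonal_exp\<close>).\<close>

section \<open>Second moments and Gaussian variables\<close>

lemma (in prob_space) square_expectation_le_L2norm_sq:
  assumes "integrable M Z"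
  shows "ennreal ((expectation Z)\<^sup>2) \<le> L2norm_sq M Z"
proof (cases "L2norm_sq M Z = \<infinity>")
  case False
  have [measurable]: "Z \<in> borel_measurable M"
    using assms by auto
  have sq: "integrable M (\<lambda>w. (Z w)\<^sup>2)"
    using False by (intro integrableI_nonneg) (auto simp: L2norm_sq_def top.not_eq_extremum)
  have "(expectation Z)\<^sup>2 \<le> expectation (\<lambda>w. (Z w)\<^sup>2)"
    using variance_eq[OF assms sq] variance_positive[of Z] by simp
  also have "ennreal \<dots> = L2norm_sq M Z"
    using sq by (simp add: L2norm_sq_def nn_integral_eq_integral)
  finally show ?thesis
    by (simp add: ennreal_leI)
qed simp

lemma (in prob_space) integrable_of_L2norm_sq:
  assumes [measurable]: "Z \<in> borel_measurable M" and "L2norm_sq M Z < \<infinity>"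
  shows "integrable M Z"
proof (rule square_integrable_imp_integrable)
  show "integrable M (\<lambda>w. (Z w)\<^sup>2)"
    using assms by (intro integrableI_nonneg) (auto simp: L2norm_sq_def)
qed simp

lemma integrable_mult_of_squares:
  fixes f g :: "'a \<Rightarrow> real"
  assumes [measurable]: "f \<in> borel_measurable M" "g \<in> borel_measurable M"
    and "integrable M (\<lambda>w. (f w)\<^sup>2)" "integrable M (\<lambda>w. (g w)\<^sup>2)"
  shows "integrable M (\<lambda>w. f w * g w)"
proof (rule Bochner_Integration.integrable_bound)
  show "integrable M (\<lambda>w. (f w)\<^sup>2 + (g w)\<^sup>2)"
    using assms by simp
  have "\<bar>x * y\<bar> \<le> x\<^sup>2 + y\<^sup>2" for x y :: real
    using sum_squares_bound[of "\<bar>x\<bar>" "\<bar>y\<bar>"] abs_ge_zero[of "x * y"]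
    unfolding abs_mult power2_abs by linarith
  then show "AE w in M. norm (f w * g w) \<le> norm ((f w)\<^sup>2 + (g w)\<^sup>2)"
    by simp
qed simp

lemma (in prob_space) gaussian_square_integrable:
  assumes "gaussian_rv M X"
  shows "integrable M (\<lambda>w. (X w)\<^sup>2)"
proof -
  have [measurable]: "X \<in> borel_measurable M"
    using assms by (simp add: gaussian_rv_def)
  consider (const) m where "AE w in M. X w = m"
    | (normal) m s where "s > 0" "distributed M lborel X (\<lambda>x. ennreal (normal_density m s x))"
    using assms by (auto simp: gaussian_rv_def)
  then show ?thesis
  proof cases
    case const
    show ?thesis
    proof (rule integrable_cong_AE_imp[of M "\<lambda>w. m\<^sup>2"])
      show "AE w in M. m\<^sup>2 = (X w)\<^sup>2"
        using const by eventually_elim simp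
    qed auto
  next
    case normal
    have "integrable lborel (\<lambda>x. normal_density m s x * (x - m)\<^sup>2
            + 2 * m * (normal_density m s x * (x - m) ^ 1)
            + m\<^sup>2 * (normal_density m s x * (x - m) ^ 0))"
      using integrable_normal_moment[OF normal(1), of m]
      by (intro Bochner_Integration.integrable_add integrable_mult_right) blast+
    also have "(\<lambda>x. normal_density m s x * (x - m)\<^sup>2
            + 2 * m * (normal_density m s x * (x - m) ^ 1)
            + m\<^sup>2 * (normal_density m s x * (x - m) ^ 0)) = (\<lambda>x. normal_density m s x * x\<^sup>2)"
      by (auto simp: power2_eq_square algebra_simps)
    finally show ?thesis
      using distributed_integrable[OF normal(2), of "\<lambda>x. x\<^sup>2"] by simp
  qed
qed

lemma (in prob_space) centred_gaussian_characteristic: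
  assumes "gaussian_rv M X" and "expectation X = 0"
  shows "(CLINT w|M. iexp (X w)) = exp (- expectation (\<lambda>w. (X w)\<^sup>2) / 2)"
proof -
  have [measurable]: "X \<in> borel_measurable M"
    using assms by (simp add: gaussian_rv_def)
  consider (const) m where "AE w in M. X w = m"
    | (normal) m s where "s > 0" "distributed M lborel X (\<lambda>x. ennreal (normal_density m s x))"
    using assms by (auto simp: gaussian_rv_def)
  then show ?thesis
  proof cases
    case const
    have "expectation X = expectation (\<lambda>w. m)"
      using const by (intro integral_cong_AE) auto
    then have X0: "AE w in M. X w = 0"
      using const assms(2) by (simp add: prob_space)
    have "(CLINT w|M. iexp (X w)) = (CLINT w|M. 1)"
      using X0 by (intro integral_cong_AE) auto
    moreover have "expectation (\<lambda>w. (X w)\<^sup>2) = expectation (\<lambda>w. 0)"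
      using X0 by (intro integral_cong_AE) auto
    ultimately show ?thesis
      by (simp add: prob_space)
  next
    case normal
    have m: "m = 0"
      using normal_distributed_expectation[OF normal] assms(2) by simp
    have var: "expectation (\<lambda>w. (X w)\<^sup>2) = s\<^sup>2"
      using normal_distributed_variance[OF normal] assms(2) by simp
    have "distributed M lborel (\<lambda>w. (X w - m) / s) (\<lambda>x. ennreal (std_normal_density x))"
      using normal_standard_normal_convert[OF normal(1)] normal(2) by blast
    then have "distr M lborel (\<lambda>w. X w / s) = std_normal_distribution"
      by (simp add: distributed_def m)
    then have "char std_normal_distribution s = (CLINT w|M. iexp (s * (X w / s)))"
      unfolding char_def by (subst integral_distr[symmetric, where N = lborel]) auto
    then show ?thesis
      using normal(1) by (simp add: char_std_normal_distribution var)
  qed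
qed

text \<open>Uncorrelated jointly Gaussian variables are independent; this is the trace of that fact which is
needed below. Since \<open>f + t D\<close> is a centred Gaussian with variance \<open>E f\<^sup>2 + t\<^sup>2 E D\<^sup>2\<close>, its characteristic
function \<open>t \<mapsto> E exp (i (f + t D))\<close> is even in \<open>t\<close>, and its derivative at \<open>t = 0\<close> is \<open>i E (D exp (i f))\<close>.\<close>

lemma (in prob_space) orthogonal_exp_of_uncorrelated_gaussian:
  assumes gauss: "\<And>t. gaussian_rv M (\<lambda>w. f w + t * D w)"
    and D: "gaussian_rv M D"
    and mean: "expectation f = 0" "expectation D = 0"
    and uncorr: "expectation (\<lambda>w. f w * D w) = 0"
  shows "(CLINT w|M. D w * iexp (f w)) = 0"
proof -
  have f: "gaussian_rv M f"
    using gauss[of 0] by simp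
  have [measurable]: "f \<in> borel_measurable M" "D \<in> borel_measurable M"
    using f D by (auto simp: gaussian_rv_def)
  note sq = gaussian_square_integrable[OF f] gaussian_square_integrable[OF D]
  have int: "integrable M f" "integrable M D"
    using sq by (auto intro: square_integrable_imp_integrable)
  have prod: "integrable M (\<lambda>w. f w * D w)"
    using sq by (intro integrable_mult_of_squares) auto
  define v where "v = expectation (\<lambda>w. (D w)\<^sup>2)"
  define c where "c = expectation (\<lambda>w. (f w)\<^sup>2)"
  define a where "a = (CLINT w|M. D w * iexp (f w))"
  have v: "v \<ge> 0" and c: "c \<ge> 0"
    by (auto simp: v_def c_def)
  have intDe: "integrable M (\<lambda>w. D w * iexp (f w))"
    by (rule Bochner_Integration.integrable_bound[OF int(2)]) (auto simp: norm_mult)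
  have phi: "(CLINT w|M. iexp (f w + t * D w)) = exp (- (c + t\<^sup>2 * v) / 2)" for t
  proof -
    have "expectation (\<lambda>w. (f w + t * D w)\<^sup>2)
        = expectation (\<lambda>w. (f w)\<^sup>2 + t\<^sup>2 * (D w)\<^sup>2 + 2 * t * (f w * D w))"
      by (intro Bochner_Integration.integral_cong) (auto simp: power2_eq_square algebra_simps)
    also have "\<dots> = c + t\<^sup>2 * v"
      using sq prod uncorr by (simp add: c_def v_def)
    finally have "expectation (\<lambda>w. (f w + t * D w)\<^sup>2) = c + t\<^sup>2 * v" .
    then show ?thesis
      using centred_gaussian_characteristic[OF gauss[of t]] int mean by simp
  qed
  \<comment> \<open>Two estimates replace the differentiation at \<open>t = 0\<close>: the second order remainder of the exponential
    and the change of the characteristic function between \<open>0\<close> and \<open>t\<close> are both at most \<open>t\<^sup>2 v / 2\<close>.\<close>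
  have bound: "norm a \<le> t * v" if t: "t > 0" for t
  proof -
    have ie: "integrable M (\<lambda>w. iexp (f w + s * D w))" for s
      by (rule integrable_const_bound[of _ 1]) auto
    let ?r = "\<lambda>w. iexp (f w + t * D w) - iexp (f w + 0 * D w) - \<i> * t * (D w * iexp (f w))"
    have r: "norm (?r w) \<le> t\<^sup>2 / 2 * (D w)\<^sup>2" for w
    proof -
      have "?r w = iexp (f w) * (iexp (t * D w) - (\<Sum>k\<le>1. (\<i> * (t * D w)) ^ k / fact k))"
        by (simp add: exp_add algebra_simps)
      also have "norm \<dots> \<le> \<bar>t * D w\<bar> ^ Suc 1 / fact (Suc 1)"
        using iexp_approx1[of "t * D w" 1] by (simp add: norm_mult)
      finally show ?thesis
        by (simp add: power2_eq_square abs_mult_self_eq power_mult_distrib algebra_simps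
              flip: abs_mult)
    qed
    have "(CLINT w|M. ?r w) = exp (- (c + t\<^sup>2 * v) / 2) - exp (- (c + 0\<^sup>2 * v) / 2) - \<i> * t * a"
      using ie[of t] ie[of 0] intDe phi[of t] phi[of 0] by (simp add: a_def)
    moreover have "norm (CLINT w|M. ?r w) \<le> expectation (\<lambda>w. t\<^sup>2 / 2 * (D w)\<^sup>2)"
      by (rule order_trans[OF integral_norm_bound integral_mono])
        (use ie[of t] ie[of 0] intDe sq r in auto)
    ultimately have 1: "norm (complex_of_real (exp (- (c + t\<^sup>2 * v) / 2) - exp (- c / 2)) - \<i> * t * a) \<le> t\<^sup>2 / 2 * v"
      using sq by (simp add: v_def)
    have 2: "\<bar>exp (- (c + t\<^sup>2 * v) / 2) - exp (- c / 2)\<bar> \<le> t\<^sup>2 / 2 * v"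
    proof -
      have e: "exp (- (c + t\<^sup>2 * v) / 2) - exp (- c / 2) = - (exp (- c / 2) * (1 - exp (- (t\<^sup>2 * v / 2))))"
        by (simp add: field_simps flip: exp_add)
      have "1 - exp (- (t\<^sup>2 * v / 2)) \<le> t\<^sup>2 * v / 2"
        using exp_ge_add_one_self[of "- (t\<^sup>2 * v / 2)"] by simp
      moreover have "0 \<le> 1 - exp (- (t\<^sup>2 * v / 2))"
        using v by simp
      moreover have "exp (- c / 2) \<le> 1"
        using c by simp
      ultimately have "exp (- c / 2) * (1 - exp (- (t\<^sup>2 * v / 2))) \<le> 1 * (t\<^sup>2 * v / 2)"
        by (intro mult_mono) auto
      moreover have "0 \<le> exp (- c / 2) * (1 - exp (- (t\<^sup>2 * v / 2)))"
        using v by simp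
      ultimately show ?thesis
        unfolding e by simp
    qed
    have "norm z \<le> \<bar>e\<bar> + norm (complex_of_real e - z)" for e z
      using norm_triangle_ineq4[of "complex_of_real e" "complex_of_real e - z"] by simp
    from order_trans[OF this add_mono[OF 2 1]]
    have "norm (\<i> * t * a) \<le> t\<^sup>2 / 2 * v + t\<^sup>2 / 2 * v" .
    then have "t * norm a \<le> t * (t * v)"
      using t by (simp add: norm_mult power2_eq_square)
    then show ?thesis
      using t by simp
  qed
  have "((\<lambda>t. t * v) \<longlongrightarrow> 0 * v) (at_right 0)"
    by (intro tendsto_intros)
  then have "norm a \<le> 0 * v"
    by (rule tendsto_lowerbound) (auto simp: eventually_at_filter bound)
  then show ?thesis
    by (simp add: a_def)
qed

section \<open>Orthogonality to exponentials and to events\<close>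

text \<open>Fourier uniqueness for the signed measure \<open>B \<mapsto> E (Z 1\<^bsub>Y \<in> B\<^esub>)\<close>. Its transform vanishes, so the laws
of \<open>Y\<close> under the densities \<open>Z\<^sup>+\<close> and \<open>Z\<^sup>-\<close>, both normalised by the common mass \<open>E Z\<^sup>+ = E Z\<^sup>-\<close> (the
transform at \<open>0\<close>), have the same characteristic function, and Levy's uniqueness theorem identifies
them.\<close>

lemma (in prob_space) integral_indicator_eq_0_of_transform:
  fixes Z :: "'a \<Rightarrow> real"
  assumes Z: "integrable M Z" and Y [measurable]: "Y \<in> borel_measurable M"
    and transform: "\<And>s. (CLINT w|M. Z w * iexp (s * Y w)) = 0"
    and B [measurable]: "B \<in> sets borel"
  shows "(LINT w|M. Z w * indicator B (Y w)) = 0"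
proof -
  have [measurable]: "Z \<in> borel_measurable M"
    using Z by auto
  define P where "P = (\<lambda>w. max (Z w) 0)"
  define N where "N = (\<lambda>w. max (- Z w) 0)"
  define c where "c = expectation P"
  have int: "integrable M P" "integrable M N"
    using Z by (auto simp: P_def N_def)
  have [measurable]: "P \<in> borel_measurable M" "N \<in> borel_measurable M"
    using int by auto
  have nonneg: "P w \<ge> 0" "N w \<ge> 0" for w
    by (auto simp: P_def N_def)
  have Z_eq: "Z w = P w - N w" for w
    by (auto simp: P_def N_def)
  have "complex_of_real (expectation Z) = 0"
    using transform[of 0] by simp
  moreover have "expectation Z = expectation P - expectation N"
    using int by (simp flip: Z_eq Bochner_Integration.integral_diff)
  ultimately have cN: "c = expectation N"
    by (simp add: c_def)
  have c0: "c \<ge> 0"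
    using nonneg by (simp add: c_def)
  show ?thesis
  proof (cases "c = 0")
    case True
    have "AE w in M. P w = 0" "AE w in M. N w = 0"
      using True cN c_def integral_nonneg_eq_0_iff_AE[OF int(1)] integral_nonneg_eq_0_iff_AE[OF int(2)]
        nonneg by auto
    then have "AE w in M. Z w * indicator B (Y w) = 0"
      by eventually_elim (simp add: Z_eq)
    then have "(LINT w|M. Z w * indicator B (Y w)) = (LINT w|M. 0)"
      by (intro integral_cong_AE) auto
    then show ?thesis
      by simp
  next
    case False
    with c0 have c: "c > 0"
      by simp
    define \<mu> where "\<mu> f = distr (density M (\<lambda>w. ennreal (f w / c))) borel Y" for f :: "'a \<Rightarrow> real"
    have dist: "real_distribution (\<mu> f)"
      if f: "integrable M f" "\<And>w. f w \<ge> 0" "expectation f = c" for f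
    proof -
      have [measurable]: "f \<in> borel_measurable M"
        using f by auto
      have "(\<integral>\<^sup>+w. ennreal (f w / c) \<partial>M) = ennreal (LINT w|M. f w / c)"
        using f c by (intro nn_integral_eq_integral) auto
      also have "\<dots> = 1"
        using f(3) c by simp
      finally have "prob_space (density M (\<lambda>w. ennreal (f w / c)))"
        by (intro prob_spaceI) (simp add: emeasure_density cong: nn_integral_cong)
      then show ?thesis
        unfolding \<mu>_def by (intro prob_space.real_distribution_distr) auto
    qed
    have integral_\<mu>: "integral\<^sup>L (\<mu> f) g = (LINT w|M. (f w / c) *\<^sub>R g (Y w))"
      if [measurable]: "f \<in> borel_measurable M" "g \<in> borel_measurable borel" and "\<And>w. f w \<ge> 0"
      for f and g :: "real \<Rightarrow> 'b :: {banach, second_countable_topology}"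
      using that c by (simp add: \<mu>_def integral_distr integral_density)
    have "char (\<mu> P) = char (\<mu> N)"
    proof
      fix t
      have i: "integrable M (\<lambda>w. (f w / c) *\<^sub>R iexp (t * Y w))" if "integrable M f" for f :: "'a \<Rightarrow> real"
      proof (rule Bochner_Integration.integrable_bound)
        show "integrable M (\<lambda>w. f w / c)"
          using that by simp
      qed (use that in \<open>auto simp: norm_mult\<close>)
      have "char (\<mu> P) t - char (\<mu> N) t
          = (CLINT w|M. (P w / c) *\<^sub>R iexp (t * Y w)) - (CLINT w|M. (N w / c) *\<^sub>R iexp (t * Y w))"
        unfolding char_def using nonneg by (simp add: integral_\<mu>)
      also have "\<dots> = (CLINT w|M. (P w / c) *\<^sub>R iexp (t * Y w) - (N w / c) *\<^sub>R iexp (t * Y w))"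
        using i[OF int(1)] i[OF int(2)] by (rule Bochner_Integration.integral_diff[symmetric])
      also have "\<dots> = (CLINT w|M. (1 / c) * (Z w * iexp (t * Y w)))"
        by (intro Bochner_Integration.integral_cong) (auto simp: Z_eq scaleR_conv_of_real algebra_simps)
      also have "\<dots> = 0"
        using transform[of t] by simp
      finally show "char (\<mu> P) t = char (\<mu> N) t"
        by simp
    qed
    then have "\<mu> P = \<mu> N"
      using int nonneg cN by (intro Levy_uniqueness dist) (auto simp: c_def)
    then have "(LINT w|M. (P w / c) *\<^sub>R (indicator B (Y w) :: real)) = (LINT w|M. (N w / c) *\<^sub>R indicator B (Y w))"
      using nonneg integral_\<mu>[of P "indicator B :: real \<Rightarrow> real"] integral_\<mu>[of N "indicator B :: real \<Rightarrow> real"] by simp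
    then have eq: "(LINT w|M. P w * indicator B (Y w)) = (LINT w|M. N w * indicator B (Y w))"
      using c by simp
    have i: "integrable M (\<lambda>w. f w * indicator B (Y w))" if "integrable M f" for f :: "'a \<Rightarrow> real"
      by (rule Bochner_Integration.integrable_bound[OF that]) (use that in \<open>auto simp: indicator_def\<close>)
    show ?thesis
      using i[OF int(1)] i[OF int(2)] eq by (simp add: Z_eq left_diff_distrib)
  qed
qed

text \<open>If the transform of \<open>Z\<close> vanishes at every frequency, so does that of the conjugate of \<open>Z\<close>, by
conjugation and \<open>s \<mapsto> - s\<close>; hence the real and the imaginary part of \<open>Z\<close> fall under the real case.\<close>

lemma (in prob_space) complex_integral_indicator_eq_0_of_transform:
  fixes Z :: "'a \<Rightarrow> complex"
  assumes Z: "integrable M Z" and Y [measurable]: "Y \<in> borel_measurable M"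
    and transform: "\<And>s. (CLINT w|M. Z w * iexp (s * Y w)) = 0"
    and B [measurable]: "B \<in> sets borel"
  shows "(CLINT w|M. Z w * indicator B (Y w)) = 0"
proof -
  have [measurable]: "Z \<in> borel_measurable M"
    using Z by auto
  have [measurable]: "(\<lambda>w. cnj (Z w)) \<in> borel_measurable M"
    using integrable_cnj[OF Z] by (rule borel_measurable_integrable)
  have int: "integrable M (\<lambda>w. Z w * iexp (s * Y w))" "integrable M (\<lambda>w. cnj (Z w) * iexp (s * Y w))" for s
    by (rule Bochner_Integration.integrable_bound[OF Z]; auto simp: norm_mult)+
  have conj: "(CLINT w|M. cnj (Z w) * iexp (s * Y w)) = 0" for s
  proof -
    have "(CLINT w|M. cnj (Z w) * iexp (s * Y w)) = (CLINT w|M. cnj (Z w * iexp (- s * Y w)))"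
      by (intro Bochner_Integration.integral_cong) (auto simp: exp_cnj)
    also have "\<dots> = 0"
      using transform[of "- s"] by (simp only: Bochner_Integration.integral_cnj complex_cnj_zero)
    finally show ?thesis .
  qed
  have Re0: "(LINT w|M. Re (Z w) * indicator B (Y w)) = 0"
  proof (rule integral_indicator_eq_0_of_transform)
    fix s
    have "(CLINT w|M. Re (Z w) * iexp (s * Y w))
        = (CLINT w|M. (Z w * iexp (s * Y w) + cnj (Z w) * iexp (s * Y w)) / 2)"
      by (intro Bochner_Integration.integral_cong) (auto simp: complex_add_cnj simp flip: distrib_right)
    also have "\<dots> = 0"
      using transform conj int by simp
    finally show "(CLINT w|M. Re (Z w) * iexp (s * Y w)) = 0" .
  qed (use Z in auto)
  have Im0: "(LINT w|M. Im (Z w) * indicator B (Y w)) = 0"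
  proof (rule integral_indicator_eq_0_of_transform)
    fix s
    have "(CLINT w|M. Im (Z w) * iexp (s * Y w))
        = (CLINT w|M. (Z w * iexp (s * Y w) - cnj (Z w) * iexp (s * Y w)) / (2 * \<i>))"
    proof (intro Bochner_Integration.integral_cong refl)
      fix w
      have nz: "2 * \<i> \<noteq> 0"
        by simp
      have "Z w * iexp (s * Y w) - cnj (Z w) * iexp (s * Y w) = (2 * \<i>) * (Im (Z w) * iexp (s * Y w))"
        unfolding left_diff_distrib[symmetric] complex_diff_cnj by (simp add: ac_simps)
      then show "Im (Z w) * iexp (s * Y w) = (Z w * iexp (s * Y w) - cnj (Z w) * iexp (s * Y w)) / (2 * \<i>)"
        by (simp only: nonzero_mult_div_cancel_left[OF nz])
    qed
    also have "\<dots> = 0"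
      using transform conj int by simp
    finally show "(CLINT w|M. Im (Z w) * iexp (s * Y w)) = 0" .
  qed (use Z in auto)
  have ind: "integrable M (\<lambda>w. Z w * indicator B (Y w))"
    by (rule Bochner_Integration.integrable_bound[OF Z]) (auto simp: norm_mult indicator_def)
  have "Re (Z w * indicator B (Y w)) = Re (Z w) * indicator B (Y w)"
    "Im (Z w * indicator B (Y w)) = Im (Z w) * indicator B (Y w)" for w
    by (auto simp: indicator_def)
  then show ?thesis
    using Re0 Im0 ind by (simp add: complex_eq_iff flip: integral_Re integral_Im)
qed

text \<open>A variable that is orthogonal to the exponentials \<open>exp (i f)\<close> of a vector space of random variables is
orthogonal to every event which that space generates. One-dimensional Fourier uniqueness suffices
when the generating events are imposed one at a time: the proof keeps, for each event \<open>E\<close> reached so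
far, orthogonality to all products \<open>1\<^bsub>E\<^esub> exp (i f)\<close>, and imposing a further event \<open>g \<in> B\<close> uses
uniqueness in the single direction \<open>g\<close>, because \<open>f + s g\<close> stays in the space.\<close>

lemma (in prob_space) orthogonal_sigma_of_orthogonal_exp:
  fixes D :: "'a \<Rightarrow> real"
  assumes D: "integrable M D"
    and V: "V \<subseteq> borel_measurable M" and zero: "(\<lambda>w. 0) \<in> V"
    and lin: "\<And>f g s. f \<in> V \<Longrightarrow> g \<in> V \<Longrightarrow> (\<lambda>w. f w + s * g w) \<in> V"
    and orth: "\<And>f. f \<in> V \<Longrightarrow> (CLINT w|M. D w * iexp (f w)) = 0"
    and G: "G \<in> sigma_sets (space M)
      (null_sets M \<union> {g -` B \<inter> space M | g B. g \<in> V \<and> B \<in> sets borel})"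
  shows "(LINT w|M. D w * indicator G w) = 0"
proof -
  have [measurable]: "D \<in> borel_measurable M"
    using D by auto
  define C where "C E \<longleftrightarrow> E \<in> sets M \<and> (\<forall>f\<in>V. (CLINT w|M. D w * indicator E w * iexp (f w)) = 0)" for E
  have orth_exp: "(CLINT w|M. D w * indicator E w * iexp (f w)) = 0" if "C E" "f \<in> V" for E f
    using that by (simp add: C_def)
  have CE: "E \<in> sets M" if "C E" for E
    using that by (simp add: C_def)
  have int: "integrable M (\<lambda>w. D w * indicator E w * iexp (f w))" if "f \<in> V" "E \<in> sets M" for f and E
  proof (rule Bochner_Integration.integrable_bound[OF D])
    have [measurable]: "f \<in> borel_measurable M"
      using that V by auto
    show "(\<lambda>w. D w * indicator E w * iexp (f w)) \<in> borel_measurable M"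
      using that by measurable
  qed (auto simp: norm_mult indicator_def)
  have compl: "C (E \<inter> (space M - A))" if "C E" "C (E \<inter> A)" for E A
    unfolding C_def
  proof (intro conjI ballI)
    have E: "E \<inter> (space M - A) = E - (E \<inter> A)"
      using sets.sets_into_space[OF CE[OF that(1)]] by auto
    show [measurable]: "E \<inter> (space M - A) \<in> sets M"
      unfolding E using that by (auto dest: CE)
    fix f assume f: "f \<in> V"
    have "(CLINT w|M. D w * indicator (E \<inter> (space M - A)) w * iexp (f w))
        = (CLINT w|M. D w * indicator E w * iexp (f w) - D w * indicator (E \<inter> A) w * iexp (f w))"
      by (intro Bochner_Integration.integral_cong) (auto simp: indicator_def)
    also have "\<dots> = 0"
      using that int[OF f CE] f by (simp add: C_def)
    finally show "(CLINT w|M. D w * indicator (E \<inter> (space M - A)) w * iexp (f w)) = 0" .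
  qed
  \<comment> \<open>Quantifying over all \<open>E\<close> makes the family of admissible \<open>G\<close> closed under intersections, so it is a
    \<open>\<sigma>\<close>-algebra although the generator is not closed under intersections.\<close>
  have K: "C (E \<inter> G)" if "C E" for E
    using G that
  proof (induction arbitrary: E rule: sigma_sets.induct)
    case (Basic A)
    note E = CE[OF Basic(2)]
    from Basic(1) consider (null) "A \<in> null_sets M"
      | (gen) g B where "A = g -` B \<inter> space M" "g \<in> V" "B \<in> sets borel"
      by auto
    then show ?case
    proof cases
      case null
      show ?thesis
        unfolding C_def
      proof (intro conjI ballI)
        show EA: "E \<inter> A \<in> sets M"
          using E null by auto
        fix f assume f: "f \<in> V"
        have "AE w in M. w \<notin> A"
          using null by (rule AE_not_in)
        then have "AE w in M. D w * indicator (E \<inter> A) w * iexp (f w) = 0"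
          by eventually_elim simp
        then have "(CLINT w|M. D w * indicator (E \<inter> A) w * iexp (f w)) = (CLINT w|M. 0)"
          using int[OF f EA] by (intro integral_cong_AE) auto
        then show "(CLINT w|M. D w * indicator (E \<inter> A) w * iexp (f w)) = 0"
          by simp
      qed
    next
      case gen
      have [measurable]: "g \<in> borel_measurable M" "B \<in> sets borel"
        using gen V by auto
      show ?thesis
        unfolding C_def
      proof (intro conjI ballI)
        show "E \<inter> A \<in> sets M"
          unfolding gen(1) using E by simp
        fix f assume f: "f \<in> V"
        have "(CLINT w|M. (D w * indicator E w * iexp (f w)) * indicator B (g w)) = 0"
        proof (rule complex_integral_indicator_eq_0_of_transform)
          fix s
          have "(CLINT w|M. D w * indicator E w * iexp (f w + s * g w)) = 0"
            by (rule orth_exp[OF Basic(2) lin[OF f gen(2)]])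
          moreover have "(CLINT w|M. D w * indicator E w * iexp (f w) * iexp (s * g w))
              = (CLINT w|M. D w * indicator E w * iexp (f w + s * g w))"
            by (intro Bochner_Integration.integral_cong) (auto simp: exp_add algebra_simps)
          ultimately show "(CLINT w|M. D w * indicator E w * iexp (f w) * iexp (s * g w)) = 0"
            by simp
        qed (use int[OF f E] in auto)
        moreover have "(CLINT w|M. (D w * indicator E w * iexp (f w)) * indicator B (g w))
            = (CLINT w|M. D w * indicator (E \<inter> A) w * iexp (f w))"
          unfolding gen(1) by (intro Bochner_Integration.integral_cong) (auto simp: indicator_def)
        ultimately show "(CLINT w|M. D w * indicator (E \<inter> A) w * iexp (f w)) = 0"
          by simp
      qed
    qed
  next
    case Empty
    show ?case
      by (simp add: C_def)
  next
    case (Compl A)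
    then show ?case
      by (intro compl)
  next
    case (Union a)
    define A where "A i = space M - a i" for i
    note E = CE[OF Union.prems]
    \<comment> \<open>A countable union is reached through the decreasing finite intersections of the complements.\<close>
    have fin: "C (E \<inter> (\<Inter>i<n. A i))" for n
    proof (induction n)
      case 0
      show ?case
        using Union.prems by simp
    next
      case (Suc n)
      have "E \<inter> (\<Inter>i<Suc n. A i) = (E \<inter> (\<Inter>i<n. A i)) \<inter> (space M - a n)"
        by (auto simp: A_def lessThan_Suc)
      then show ?case
        using compl[OF Suc Union.IH[OF Suc]] by simp
    qed
    have meas: "E \<inter> (\<Inter>i. A i) \<in> sets M"
    proof -
      have "E \<inter> (\<Inter>i. A i) = (\<Inter>n. E \<inter> (\<Inter>i<n. A i))"
        by auto
      also have "\<dots> \<in> sets M"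
        using CE[OF fin] by (intro sets.countable_INT) auto
      finally show ?thesis .
    qed
    have "C (E \<inter> (\<Inter>i. A i))"
      unfolding C_def
    proof (intro conjI ballI meas)
      fix f assume f: "f \<in> V"
      have "(\<lambda>n. CLINT w|M. D w * indicator (E \<inter> (\<Inter>i<n. A i)) w * iexp (f w))
          \<longlonglongrightarrow> (CLINT w|M. D w * indicator (E \<inter> (\<Inter>i. A i)) w * iexp (f w))"
      proof (rule integral_dominated_convergence[where w = "\<lambda>w. norm (D w)"])
        show "AE w in M. (\<lambda>n. D w * indicator (E \<inter> (\<Inter>i<n. A i)) w * iexp (f w))
            \<longlonglongrightarrow> D w * indicator (E \<inter> (\<Inter>i. A i)) w * iexp (f w)"
          unfolding indicator_inter_arith
          by (intro AE_I2 tendsto_intros LIMSEQ_indicator_INT)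
      qed (use D int[OF f CE[OF fin]] int[OF f meas] in \<open>auto simp: norm_mult indicator_def\<close>)
      moreover have "(CLINT w|M. D w * indicator (E \<inter> (\<Inter>i<n. A i)) w * iexp (f w)) = 0" for n
        using fin[of n] f by (simp add: C_def)
      ultimately show "(CLINT w|M. D w * indicator (E \<inter> (\<Inter>i. A i)) w * iexp (f w)) = 0"
        by (simp add: LIMSEQ_const_iff)
    qed
    from compl[OF Union.prems this] have "C (E \<inter> (space M - (\<Inter>i. A i)))" .
    moreover have "E \<inter> (space M - (\<Inter>i. A i)) = E \<inter> (\<Union>i. a i)"
      using sets.sets_into_space[OF E] by (auto simp: A_def)
    ultimately show ?case
      by simp
  qed
  have "C (space M)"
    unfolding C_def
  proof (intro conjI ballI)
    fix f assume f: "f \<in> V"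
    have "(CLINT w|M. D w * indicator (space M) w * iexp (f w)) = (CLINT w|M. D w * iexp (f w))"
      by (intro Bochner_Integration.integral_cong) auto
    then show "(CLINT w|M. D w * indicator (space M) w * iexp (f w)) = 0"
      using orth[OF f] by simp
  qed simp
  from K[OF this] have "C (space M \<inter> G)" .
  with zero have "(CLINT w|M. D w * indicator (space M \<inter> G) w) = 0"
    unfolding C_def by force
  moreover have "(CLINT w|M. complex_of_real (D w * indicator G w)) = (CLINT w|M. D w * indicator (space M \<inter> G) w)"
    by (intro Bochner_Integration.integral_cong) (auto simp: indicator_def)
  ultimately show ?thesis
    by (simp only: integral_complex_of_real of_real_0 of_real_eq_0_iff)
qed

section \<open>Increments of the noise are orthogonal to the past\<close>

text \<open>The Gaussian space spanned by \<open>W A\<close> for \<open>A \<in> \<A>\<close>. Joint Gaussianity of the noise means that all its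
elements are Gaussian when the sets \<open>A\<close> are admissible.\<close>

definition linear_noise ::
    "((real \<times> real) set \<Rightarrow> 'w \<Rightarrow> real) \<Rightarrow> (real \<times> real) set set \<Rightarrow> ('w \<Rightarrow> real) set" where
  "linear_noise W \<A> = {\<lambda>w. \<Sum>A\<in>F. c A * W A w | F c. finite F \<and> F \<subseteq> \<A>}"

lemma linear_noise_mono: "\<A> \<subseteq> \<B> \<Longrightarrow> linear_noise W \<A> \<subseteq> linear_noise W \<B>"
  unfolding linear_noise_def by blast

lemma linear_noise_zero: "(\<lambda>w. 0) \<in> linear_noise W \<A>"
  unfolding linear_noise_def by (auto intro!: exI[of _ "{}"])

lemma linear_noise_single: "A \<in> \<A> \<Longrightarrow> W A \<in> linear_noise W \<A>"
  unfolding linear_noise_def by (auto intro!: exI[of _ "{A}"] exI[of _ "\<lambda>_. 1"])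

lemma linear_noise_add_scaled:
  assumes "f \<in> linear_noise W \<A>" "g \<in> linear_noise W \<A>"
  shows "(\<lambda>w. f w + s * g w) \<in> linear_noise W \<A>"
proof -
  obtain F c where f: "f = (\<lambda>w. \<Sum>A\<in>F. c A * W A w)" "finite F" "F \<subseteq> \<A>"
    using assms(1) by (auto simp: linear_noise_def)
  obtain G d where g: "g = (\<lambda>w. \<Sum>A\<in>G. d A * W A w)" "finite G" "G \<subseteq> \<A>"
    using assms(2) by (auto simp: linear_noise_def)
  define e where "e A = (if A \<in> F then c A else 0) + s * (if A \<in> G then d A else 0)" for A
  have "f w + s * g w = (\<Sum>A\<in>F \<union> G. e A * W A w)" for w
  proof -
    have "f w = (\<Sum>A\<in>F \<union> G. (if A \<in> F then c A else 0) * W A w)"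
      unfolding f(1) using f(2) g(2) by (intro sum.mono_neutral_cong_left) auto
    moreover have "g w = (\<Sum>A\<in>F \<union> G. (if A \<in> G then d A else 0) * W A w)"
      unfolding g(1) using f(2) g(2) by (intro sum.mono_neutral_cong_left) auto
    ultimately show ?thesis
      by (simp only: e_def distrib_right sum.distrib sum_distrib_left mult.assoc)
  qed
  then show ?thesis
    unfolding linear_noise_def using f g by (auto intro!: exI[of _ "F \<union> G"] exI[of _ e])
qed

lemma slab_noise_set:
  assumes "A \<in> finite_borel" "t \<ge> 0"
  shows "{0..t} \<times> A \<in> noise_sets"
    and "measure lborel ({0..t} \<times> A) = t * measure lborel A"
proof -
  have [measurable]: "A \<in> sets borel"
    using assms by (simp add: finite_borel_def)
  have em: "emeasure lborel ({0..t} \<times> A) = ennreal t * emeasure lborel A"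
    unfolding lborel_prod[symmetric] using assms
    by (subst lborel.emeasure_pair_measure_Times) auto
  have "{0..t} \<times> A \<in> sets (borel \<Otimes>\<^sub>M borel)"
    by measurable
  then have "{0..t} \<times> A \<in> sets borel"
    unfolding borel_prod .
  then show "{0..t} \<times> A \<in> noise_sets"
    using assms em by (auto simp: noise_sets_def finite_borel_def ennreal_mult_less_top)
  show "measure lborel ({0..t} \<times> A) = t * measure lborel A"
    using assms em by (simp add: measure_def enn2real_mult)
qed

locale white_noise = prob_space M for M :: "'w measure" +
  fixes W :: "(real \<times> real) set \<Rightarrow> 'w \<Rightarrow> real"
  assumes noise: "space_time_white_noise M W"
begin

lemma gaussian_linear_noise: "f \<in> linear_noise W noise_sets \<Longrightarrow> gaussian_rv M f"
  using noise unfolding space_time_white_noise_def linear_noise_def by blast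

lemma measurable_linear_noise: "f \<in> linear_noise W noise_sets \<Longrightarrow> f \<in> borel_measurable M"
  using gaussian_linear_noise by (auto simp: gaussian_rv_def)

lemma integrable_linear_noise: "f \<in> linear_noise W noise_sets \<Longrightarrow> integrable M f"
  using gaussian_square_integrable gaussian_linear_noise measurable_linear_noise
  by (blast intro: square_integrable_imp_integrable)

lemma integrable_mult_linear_noise:
  "f \<in> linear_noise W noise_sets \<Longrightarrow> g \<in> linear_noise W noise_sets \<Longrightarrow> integrable M (\<lambda>w. f w * g w)"
  using gaussian_square_integrable gaussian_linear_noise measurable_linear_noise
  by (blast intro: integrable_mult_of_squares)

lemma expectation_noise: "A \<in> noise_sets \<Longrightarrow> expectation (W A) = 0"
  using noise by (simp add: space_time_white_noise_def)

lemma expectation_linear_noise: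
  assumes "f \<in> linear_noise W noise_sets"
  shows "expectation f = 0"
proof -
  obtain F c where f: "f = (\<lambda>w. \<Sum>A\<in>F. c A * W A w)" "F \<subseteq> noise_sets"
    using assms by (auto simp: linear_noise_def)
  have "expectation f = (\<Sum>A\<in>F. c A * expectation (W A))"
    unfolding f(1) using f(2) integrable_linear_noise[OF linear_noise_single]
    by (subst Bochner_Integration.integral_sum) (auto simp: subset_iff)
  also have "\<dots> = 0"
    using f(2) expectation_noise by (auto intro!: sum.neutral)
  finally show ?thesis .
qed

lemma covariance:
  "A \<in> noise_sets \<Longrightarrow> B \<in> noise_sets \<Longrightarrow> expectation (\<lambda>w. W A w * W B w) = measure lborel (A \<inter> B)"
  using noise by (simp add: space_time_white_noise_def)

lemma integrable_mult_noise:
  "A \<in> noise_sets \<Longrightarrow> B \<in> noise_sets \<Longrightarrow> integrable M (\<lambda>w. W A w * W B w)"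
  by (intro integrable_mult_linear_noise linear_noise_single)

lemma increment_linear_noise:
  assumes "A \<in> finite_borel" "0 \<le> a" "0 \<le> b"
  shows "(\<lambda>w. mart_measure W b A w - mart_measure W a A w) \<in> linear_noise W noise_sets"
  using linear_noise_add_scaled[of "W ({0..b} \<times> A)" W noise_sets "W ({0..a} \<times> A)" "-1"]
    assms slab_noise_set(1) linear_noise_single[of _ noise_sets W]
  by (simp add: mart_measure_def)

lemma expectation_increment_square:
  assumes A: "A \<in> finite_borel" and ab: "0 \<le> a" "a \<le> b"
  shows "expectation (\<lambda>w. (mart_measure W b A w - mart_measure W a A w)\<^sup>2) = (b - a) * measure lborel A"
proof -
  let ?B = "\<lambda>t. {0..t} \<times> A"
  have B: "?B a \<in> noise_sets" "?B b \<in> noise_sets"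
    using slab_noise_set(1) A ab by auto
  have sub: "?B b \<inter> ?B a = ?B a"
    using ab by auto
  have "expectation (\<lambda>w. (mart_measure W b A w - mart_measure W a A w)\<^sup>2)
      = expectation (\<lambda>w. W (?B b) w * W (?B b) w - 2 * (W (?B b) w * W (?B a) w) + W (?B a) w * W (?B a) w)"
    by (intro Bochner_Integration.integral_cong) (auto simp: mart_measure_def power2_eq_square algebra_simps)
  also have "\<dots> = measure lborel (?B b) - 2 * measure lborel (?B a) + measure lborel (?B a)"
    using B by (simp add: covariance integrable_mult_noise sub)
  also have "\<dots> = (b - a) * measure lborel A"
    using A ab by (simp add: slab_noise_set(2) algebra_simps)
  finally show ?thesis .
qed

text \<open>The sets whose noise generates the natural filtration at time \<open>a\<close>, up to null sets.\<close>

abbreviation past_slabs :: "real \<Rightarrow> (real \<times> real) set set" where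
  "past_slabs a \<equiv> {{0..s} \<times> B | s B. 0 \<le> s \<and> s \<le> a \<and> B \<in> finite_borel}"

lemma past_slabs_subset: "past_slabs a \<subseteq> noise_sets"
  using slab_noise_set(1) by auto

text \<open>The difference of the slabs at times \<open>a\<close> and \<open>b\<close> lies over the times in \<open>]a, b]\<close>, which no past slab
meets; so a past slab has the same covariance with both.\<close>

lemma increment_uncorrelated_past:
  assumes A: "A \<in> finite_borel" and ab: "0 \<le> a" "a \<le> b" and f: "f \<in> linear_noise W (past_slabs a)"
  shows "expectation (\<lambda>w. f w * (mart_measure W b A w - mart_measure W a A w)) = 0"
proof -
  let ?B = "\<lambda>t. {0..t} \<times> A"
  have B: "?B a \<in> noise_sets" "?B b \<in> noise_sets"
    using slab_noise_set(1) A ab by auto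
  obtain F c where F: "f = (\<lambda>w. \<Sum>A\<in>F. c A * W A w)" "F \<subseteq> past_slabs a"
    using f by (auto simp: linear_noise_def)
  have F': "F \<subseteq> noise_sets"
    using F(2) past_slabs_subset by blast
  have "expectation (\<lambda>w. f w * (mart_measure W b A w - mart_measure W a A w))
      = expectation (\<lambda>w. \<Sum>S\<in>F. c S * (W S w * W (?B b) w - W S w * W (?B a) w))"
    unfolding F(1) mart_measure_def sum_distrib_right
    by (intro Bochner_Integration.integral_cong refl sum.cong) (simp add: algebra_simps)
  also have "\<dots> = (\<Sum>S\<in>F. c S * (measure lborel (S \<inter> ?B b) - measure lborel (S \<inter> ?B a)))"
    using F' B by (subst Bochner_Integration.integral_sum)
      (auto simp: integrable_mult_noise covariance subset_iff intro!: sum.cong)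
  also have "\<dots> = 0"
  proof (intro sum.neutral ballI)
    fix S assume "S \<in> F"
    then obtain s B where "S = {0..s} \<times> B" "s \<le> a"
      using F(2) by blast
    then have "S \<inter> ?B b = S \<inter> ?B a"
      using ab by auto
    then show "c S * (measure lborel (S \<inter> ?B b) - measure lborel (S \<inter> ?B a)) = 0"
      by simp
  qed
  finally show ?thesis .
qed

text \<open>An increment is jointly Gaussian with, and uncorrelated to, the Gaussian space of the past, so it is
orthogonal to the exponentials of that space and hence to the events that the space generates.\<close>

lemma increment_orthogonal_past_event:
  assumes A: "A \<in> finite_borel" and ab: "0 \<le> a" "a \<le> b"
    and G: "G \<in> sets (augmented_natural_filtration M W a)"
  shows "(LINT w|M. (mart_measure W b A w - mart_measure W a A w) * indicator G w) = 0"
proof (rule orthogonal_sigma_of_orthogonal_exp[where V = "linear_noise W (past_slabs a)"])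
  let ?D = "\<lambda>w. mart_measure W b A w - mart_measure W a A w"
  have D: "?D \<in> linear_noise W noise_sets"
    using increment_linear_noise[of A a b] A ab by simp
  show "integrable M ?D"
    using D by (rule integrable_linear_noise)
  have V: "linear_noise W (past_slabs a) \<subseteq> linear_noise W noise_sets"
    by (intro linear_noise_mono past_slabs_subset)
  then show "linear_noise W (past_slabs a) \<subseteq> borel_measurable M"
    using measurable_linear_noise by blast
  show "(CLINT w|M. ?D w * iexp (f w)) = 0" if f: "f \<in> linear_noise W (past_slabs a)" for f
  proof (rule orthogonal_exp_of_uncorrelated_gaussian)
    show "gaussian_rv M (\<lambda>w. f w + t * ?D w)" for t
      using f V D by (intro gaussian_linear_noise linear_noise_add_scaled) auto
    show "gaussian_rv M ?D" "expectation ?D = 0" "expectation f = 0"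
      using f V D by (auto intro: gaussian_linear_noise expectation_linear_noise)
    show "expectation (\<lambda>w. f w * ?D w) = 0"
      using A ab f by (rule increment_uncorrelated_past)
  qed
  let ?gen = "null_sets M \<union> {mart_measure W s A -` B \<inter> space M | s A B.
      0 \<le> s \<and> s \<le> a \<and> A \<in> finite_borel \<and> B \<in> sets borel}"
  have "?gen \<subseteq> Pow (space M)"
    using sets.sets_into_space by blast
  then have "G \<in> sigma_sets (space M) ?gen"
    using G by (simp add: augmented_natural_filtration_def)
  moreover have "?gen \<subseteq> null_sets M \<union>
      {g -` B \<inter> space M | g B. g \<in> linear_noise W (past_slabs a) \<and> B \<in> sets borel}"
  proof -
    have "mart_measure W s A \<in> linear_noise W (past_slabs a)"
      if "0 \<le> s" "s \<le> a" "A \<in> finite_borel" for s A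
      using that unfolding mart_measure_def by (intro linear_noise_single) auto
    then show ?thesis
      by blast
  qed
  ultimately show "G \<in> sigma_sets (space M) (null_sets M \<union>
      {g -` B \<inter> space M | g B. g \<in> linear_noise W (past_slabs a) \<and> B \<in> sets borel})"
    using sigma_sets_mono' by blast
qed (intro linear_noise_zero linear_noise_add_scaled; assumption)+

lemma subalgebra_augmented: "subalgebra M (augmented_natural_filtration M W a)"
  unfolding subalgebra_def
proof (intro conjI)
  let ?gen = "null_sets M \<union> {mart_measure W s A -` B \<inter> space M | s A B.
      0 \<le> s \<and> s \<le> a \<and> A \<in> finite_borel \<and> B \<in> sets borel}"
  have "mart_measure W s A \<in> borel_measurable M" if "0 \<le> s" "A \<in> finite_borel" for s A
    using that unfolding mart_measure_def
    by (intro measurable_linear_noise linear_noise_single slab_noise_set)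
  then have gen: "?gen \<subseteq> sets M"
    by (auto intro: measurable_sets)
  moreover have "?gen \<subseteq> Pow (space M)"
    using sets.sets_into_space by blast
  ultimately show "sets (augmented_natural_filtration M W a) \<subseteq> sets M"
    unfolding augmented_natural_filtration_def using sets.sigma_sets_subset[OF gen] by simp
qed simp

lemma expectation_mult_increment_augmented:
  assumes A: "A \<in> finite_borel" and ab: "0 \<le> a" "a \<le> b"
    and X: "X \<in> borel_measurable (augmented_natural_filtration M W a)"
    and int: "integrable M (\<lambda>w. X w * (mart_measure W b A w - mart_measure W a A w))"
  shows "expectation (\<lambda>w. X w * (mart_measure W b A w - mart_measure W a A w)) = 0"
proof -
  let ?F = "augmented_natural_filtration M W a"
  let ?D = "\<lambda>w. mart_measure W b A w - mart_measure W a A w"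
  interpret F: finite_measure_subalgebra M ?F
    by unfold_locales (rule subalgebra_augmented)
  have D: "integrable M ?D"
    using increment_linear_noise[of A a b] A ab by (intro integrable_linear_noise) auto
  have "AE w in M. real_cond_exp M ?F ?D w = 0"
  proof (rule F.real_cond_exp_charact)
    show "(LINT w:G|M. ?D w) = (LINT w:G|M. 0)" if "G \<in> sets ?F" for G
      using increment_orthogonal_past_event[OF A ab that]
      by (simp add: set_lebesgue_integral_def mult.commute)
  qed (use D in auto)
  then have "AE w in M. X w * real_cond_exp M ?F ?D w = 0"
    by eventually_elim simp
  then have "expectation (\<lambda>w. X w * real_cond_exp M ?F ?D w) = 0"
    by (rule integral_eq_zero_AE)
  then show ?thesis
    using F.real_cond_exp_intg(2)[OF int X] D by simp
qed

lemma integrable_bounded_mult: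
  fixes D X :: "'w \<Rightarrow> real"
  assumes "integrable M D" and [measurable]: "X \<in> borel_measurable M"
    and "\<And>w. w \<in> space M \<Longrightarrow> \<bar>X w\<bar> \<le> C"
  shows "integrable M (\<lambda>w. X w * D w)"
proof (rule Bochner_Integration.integrable_bound)
  show "integrable M (\<lambda>w. C * D w)"
    using assms by simp
  have "\<bar>X w * D w\<bar> \<le> \<bar>C * D w\<bar>" if "w \<in> space M" for w
    using assms(3)[OF that] by (auto simp: abs_mult intro!: mult_right_mono)
  then show "AE w in M. norm (X w * D w) \<le> norm (C * D w)"
    by (intro AE_I2) simp
qed (use assms(1) in measurable)

text \<open>The noise is also a martingale measure for the right-continuous filtration. A variable \<open>X\<close> known
immediately after \<open>a\<close> is known at each time \<open>t > a\<close>, so it is orthogonal to the increment over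
\<open>]t, b]\<close>; the remaining increment over \<open>]a, t]\<close> has second moment \<open>(t - a) |A|\<close>, which vanishes as \<open>t\<close>
decreases to \<open>a\<close>.\<close>

lemma expectation_mult_increment:
  assumes A: "A \<in> finite_borel" and ab: "0 \<le> a" "a < b"
    and X: "X \<in> borel_measurable (noise_filtration M W a)"
    and C: "\<And>w. w \<in> space M \<Longrightarrow> \<bar>X w\<bar> \<le> C"
  shows "integrable M (\<lambda>w. X w * (mart_measure W b A w - mart_measure W a A w))"
    and "expectation (\<lambda>w. X w * (mart_measure W b A w - mart_measure W a A w)) = 0"
proof -
  let ?D = "\<lambda>t w. mart_measure W b A w - mart_measure W t A w"
  let ?E = "\<lambda>t w. mart_measure W t A w - mart_measure W a A w"
  have Xs: "X \<in> borel_measurable (augmented_natural_filtration M W s)" if "s > a" for s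
    using X that by (auto simp: measurable_def sets_noise_filtration)
  then have XM [measurable]: "X \<in> borel_measurable M"
    using measurable_from_subalg[OF subalgebra_augmented] ab by blast
  have int: "integrable M (\<lambda>w. X w * (mart_measure W t A w - mart_measure W s A w))"
    if "0 \<le> s" "0 \<le> t" for s t
    using increment_linear_noise[OF A that] XM C
    by (intro integrable_bounded_mult integrable_linear_noise)
  show "integrable M (\<lambda>w. X w * ?D a w)"
    using ab by (intro int) auto
  have bound: "(expectation (\<lambda>w. X w * ?D a w))\<^sup>2 \<le> (t - a) * (C\<^sup>2 * measure lborel A)"
    if t: "a < t" "t < b" for t
  proof -
    note intE = int[of a t]
    have "expectation (\<lambda>w. X w * ?D a w) = expectation (\<lambda>w. X w * ?D t w + X w * ?E t w)"
      by (intro Bochner_Integration.integral_cong) (auto simp: algebra_simps)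
    also have "\<dots> = expectation (\<lambda>w. X w * ?E t w)"
      using expectation_mult_increment_augmented[OF A _ _ Xs, of t b] t ab int by simp
    finally have eq: "expectation (\<lambda>w. X w * ?D a w) = expectation (\<lambda>w. X w * ?E t w)" .
    have E: "?E t \<in> linear_noise W noise_sets"
      using increment_linear_noise[of A a t] A t ab by simp
    have "ennreal ((expectation (\<lambda>w. X w * ?E t w))\<^sup>2) \<le> L2norm_sq M (\<lambda>w. X w * ?E t w)"
      using intE t ab by (intro square_expectation_le_L2norm_sq) auto
    also have "\<dots> \<le> (\<integral>\<^sup>+w. ennreal (C\<^sup>2 * (?E t w)\<^sup>2) \<partial>M)"
      unfolding L2norm_sq_def using C
      by (intro nn_integral_mono ennreal_leI)
        (auto simp: power_mult_distrib intro!: mult_right_mono power2_le_iff_abs_le[THEN iffD2] intro: order_trans[OF abs_ge_zero])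
    also have "\<dots> = ennreal (expectation (\<lambda>w. C\<^sup>2 * (?E t w)\<^sup>2))"
      using gaussian_square_integrable[OF gaussian_linear_noise[OF E]]
      by (intro nn_integral_eq_integral) auto
    also have "expectation (\<lambda>w. C\<^sup>2 * (?E t w)\<^sup>2) = (t - a) * (C\<^sup>2 * measure lborel A)"
      using expectation_increment_square[of A a t] A t ab by simp
    finally show ?thesis
      unfolding eq using t by (subst (asm) ennreal_le_iff) auto
  qed
  have "((\<lambda>t. (t - a) * (C\<^sup>2 * measure lborel A)) \<longlongrightarrow> (a - a) * (C\<^sup>2 * measure lborel A)) (at_right a)"
    by (intro tendsto_intros)
  moreover have "eventually (\<lambda>t. (expectation (\<lambda>w. X w * ?D a w))\<^sup>2 \<le> (t - a) * (C\<^sup>2 * measure lborel A)) (at_right a)"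
    using eventually_at_right_less[of a] eventually_at_right_real[OF ab(2)]
    by eventually_elim (auto intro: bound)
  ultimately have "(expectation (\<lambda>w. X w * ?D a w))\<^sup>2 \<le> (a - a) * (C\<^sup>2 * measure lborel A)"
    by (rule tendsto_lowerbound) simp
  then show "expectation (\<lambda>w. X w * ?D a w) = 0"
    by simp
qed

section \<open>Stochastic integrals are centred\<close>

lemma expectation_simple_integral:
  assumes "simple_process M W S"
  shows "integrable M (simple_integral W S)" "expectation (simple_integral W S) = 0"
proof -
  have "integrable M (simple_integral W S) \<and> expectation (simple_integral W S) = 0"
    using assms
  proof (induction S)
    case Nil
    then show ?case
      by (simp add: simple_integral_def[abs_def])
  next
    case (Cons e S)
    obtain a b A X where e: "e = (a, b, A, X)"
      by (cases e) auto
    have S: "integrable M (simple_integral W S)" "expectation (simple_integral W S) = 0"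
      using Cons by (auto simp: simple_process_def)
    have "elementary_process M W (a, b, A, X)"
      using Cons.prems by (simp add: simple_process_def e)
    then obtain C where "0 \<le> a" "a < b" "A \<in> finite_borel" "X \<in> borel_measurable (noise_filtration M W a)"
      "\<And>w. w \<in> space M \<Longrightarrow> \<bar>X w\<bar> \<le> C"
      by (auto simp: elementary_process_def)
    note inc = expectation_mult_increment[OF this(3,1,2,4,5)]
    have "simple_integral W (e # S)
        = (\<lambda>w. X w * (mart_measure W b A w - mart_measure W a A w) + simple_integral W S w)"
      by (simp add: simple_integral_def[abs_def] e)
    then show ?case
      using inc S by simp
  qed
  then show "integrable M (simple_integral W S)" "expectation (simple_integral W S) = 0"
    by auto
qed

text \<open>The Walsh integral is an \<open>L\<^sup>2\<close> limit of centred simple integrals.\<close>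

lemma expectation_walsh_integral:
  assumes walsh: "has_walsh_integral M W X I" and fin: "L2norm_sq M I < \<infinity>"
  shows "integrable M I" "expectation I = 0"
proof -
  show I: "integrable M I"
    using walsh fin by (intro integrable_of_L2norm_sq) (simp_all add: has_walsh_integral_def)
  obtain S where S: "\<And>n. simple_process M W (S n)"
    and lim: "(\<lambda>n. L2norm_sq M (\<lambda>w. simple_integral W (S n) w - I w)) \<longlonglongrightarrow> 0"
    using walsh by (auto simp: has_walsh_integral_def)
  have "ennreal ((expectation I)\<^sup>2) \<le> L2norm_sq M (\<lambda>w. simple_integral W (S n) w - I w)" for n
  proof -
    note n = expectation_simple_integral[OF S[of n]]
    show ?thesis
      using square_expectation_le_L2norm_sq[of "\<lambda>w. simple_integral W (S n) w - I w"] n I by simp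
  qed
  then have "ennreal ((expectation I)\<^sup>2) \<le> 0"
    by (intro LIMSEQ_le_const[OF lim]) auto
  then show "expectation I = 0"
    by simp
qed

end

section \<open>Divergence of the second moment condition\<close>

lemma heat_kernel_square:
  assumes "nu > 0" "t > 0"
  shows "(heat_kernel nu t x)\<^sup>2 = exp (- (x\<^sup>2 / (nu * t))) / (2 * pi * nu * t)"
proof -
  have "exp (- (x\<^sup>2 / (nu * t))) = (exp (- (x\<^sup>2 / (2 * nu * t))))\<^sup>2"
    using assms by (simp add: power2_eq_square field_simps flip: exp_add)
  then show ?thesis
    using assms by (simp add: heat_kernel_def power_divide)
qed

lemma J0_deriv_dirac_square:
  assumes "nu > 0" "t > 0"
  shows "(J0 nu (distr_deriv dirac) t x)\<^sup>2
    = x\<^sup>2 / (nu * t)\<^sup>2 * (exp (- (x\<^sup>2 / (nu * t))) / (2 * pi * nu * t))"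
proof -
  have "deriv (heat_kernel nu t) x = - (x / (nu * t)) * heat_kernel nu t x"
    using assms by (intro DERIV_imp_deriv heat_kernel_has_derivative)
  then show ?thesis
    using assms by (simp add: J0_deriv_dirac power_mult_distrib power_divide heat_kernel_square)
qed

text \<open>Only a small rectangle is used: the time \<open>r = 1 - s\<close> of the datum ranges over \<open>[d\<^sup>2, 2 d\<^sup>2]\<close> and
the space variable over \<open>[d, 2 d]\<close>, the diffusive scale. There \<open>J\<^sub>0\<^sup>2\<close> is of order \<open>1 / d\<^sup>4\<close>,
the other kernel is evaluated at a time in \<open>[1/2, 1]\<close> and is bounded below, and the area is \<open>d\<^sup>3\<close>.\<close>

lemma spacetime_conv_J0_deriv_dirac_ge:
  fixes nu lam d :: real
  assumes nu: "nu > 0" and d: "0 < d" "d \<le> 1 / 2"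
    and g: "\<And>s y. s > 0 \<Longrightarrow> g s y \<ge> ennreal ((lam * J0 nu (distr_deriv dirac) s y)\<^sup>2)"
  shows "spacetime_conv (\<lambda>s y. ennreal ((heat_kernel nu s y)\<^sup>2)) g 1 0
    \<ge> ennreal (lam\<^sup>2 * exp (- (6 / nu)) / (32 * pi\<^sup>2 * nu ^ 4) / d)"
proof -
  define k where "k = exp (- (2 / nu)) / (2 * pi * nu)"
  define l where "l = exp (- (4 / nu)) / (16 * pi * nu ^ 3 * d ^ 4)"
  have kl: "k \<ge> 0" "l \<ge> 0"
    using nu d by (auto simp: k_def l_def)
  have d2: "d\<^sup>2 \<le> 1 / 4"
    using power_mono[OF d(2), of 2] d by (simp add: power2_eq_square)
  have d2pos: "d\<^sup>2 > 0"
    using d by simp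
  have kernel: "k \<le> (heat_kernel nu s y)\<^sup>2" if s: "1 / 2 \<le> s" "s \<le> 1" and y: "d \<le> y" "y \<le> 2 * d" for s y
  proof -
    have "y\<^sup>2 \<le> (2 * d)\<^sup>2"
      using y d by (intro power_mono) auto
    then have "y\<^sup>2 \<le> 1"
      using d2 by (simp add: power_mult_distrib)
    then have "y\<^sup>2 / (nu * s) \<le> 1 / (nu * (1 / 2))"
      using nu s by (intro frac_le mult_left_mono mult_pos_pos) auto
    then have "exp (- (2 / nu)) \<le> exp (- (y\<^sup>2 / (nu * s)))"
      by simp
    then show ?thesis
      unfolding k_def using nu s by (subst heat_kernel_square) (auto intro!: frac_le)
  qed
  have datum: "l \<le> (J0 nu (distr_deriv dirac) r y)\<^sup>2"
    if r: "d\<^sup>2 \<le> r" "r \<le> 2 * d\<^sup>2" and y: "- (2 * d) \<le> y" "y \<le> - d" for r y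
  proof -
    have r0: "r > 0"
      using r d2pos by linarith
    have "\<bar>y\<bar>\<^sup>2 \<le> (2 * d)\<^sup>2" "d\<^sup>2 \<le> \<bar>y\<bar>\<^sup>2"
      using y d by (intro power_mono; simp)+
    then have y2: "y\<^sup>2 \<le> 4 * d\<^sup>2" "d\<^sup>2 \<le> y\<^sup>2"
      by (auto simp: power_mult_distrib)
    have 1: "d\<^sup>2 / (nu * (2 * d\<^sup>2))\<^sup>2 \<le> y\<^sup>2 / (nu * r)\<^sup>2"
      using nu r r0 y2(2) by (intro frac_le[OF _ y2(2)] power_mono mult_left_mono) auto
    have "y\<^sup>2 / (nu * r) \<le> 4 * d\<^sup>2 / (nu * d\<^sup>2)"
      using nu r r0 y2 d2pos by (intro frac_le mult_left_mono) auto
    also have "\<dots> = 4 / nu"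
      using d by simp
    finally have 2: "exp (- (4 / nu)) / (2 * pi * nu * (2 * d\<^sup>2)) \<le> exp (- (y\<^sup>2 / (nu * r))) / (2 * pi * nu * r)"
      using nu r r0 by (intro frac_le mult_left_mono) auto
    have "l = d\<^sup>2 / (nu * (2 * d\<^sup>2))\<^sup>2 * (exp (- (4 / nu)) / (2 * pi * nu * (2 * d\<^sup>2)))"
      unfolding l_def using nu d by (simp add: field_simps eval_nat_numeral)
    also have "\<dots> \<le> y\<^sup>2 / (nu * r)\<^sup>2 * (exp (- (y\<^sup>2 / (nu * r))) / (2 * pi * nu * r))"
      using nu d by (intro mult_mono 1 2) auto
    finally show ?thesis
      using nu r0 by (simp add: J0_deriv_dirac_square)
  qed
  have inner: "(\<integral>\<^sup>+y. ennreal ((heat_kernel nu s y)\<^sup>2) * g (1 - s) (0 - y) \<partial>lborel) \<ge> ennreal (k * (lam\<^sup>2 * l) * d)"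
    if s: "1 - 2 * d\<^sup>2 \<le> s" "s \<le> 1 - d\<^sup>2" for s
  proof -
    have "ennreal (k * (lam\<^sup>2 * l) * d) = (\<integral>\<^sup>+y. ennreal (k * (lam\<^sup>2 * l)) * indicator {d..2 * d} y \<partial>lborel)"
      using kl d by (simp add: nn_integral_cmult_indicator ennreal_mult)
    also have "\<dots> \<le> (\<integral>\<^sup>+y. ennreal ((heat_kernel nu s y)\<^sup>2) * g (1 - s) (0 - y) \<partial>lborel)"
    proof (rule nn_integral_mono)
      fix y
      show "ennreal (k * (lam\<^sup>2 * l)) * indicator {d..2 * d} y
          \<le> ennreal ((heat_kernel nu s y)\<^sup>2) * g (1 - s) (0 - y)"
      proof (cases "y \<in> {d..2 * d}")
        case True
        have "ennreal (lam\<^sup>2 * l) \<le> ennreal ((lam * J0 nu (distr_deriv dirac) (1 - s) (0 - y))\<^sup>2)"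
          using datum[of "1 - s" "0 - y"] s True
          by (auto simp: power_mult_distrib intro!: ennreal_leI mult_left_mono)
        also have "\<dots> \<le> g (1 - s) (0 - y)"
          using s d2pos by (intro g) linarith
        finally have "ennreal k * ennreal (lam\<^sup>2 * l) \<le> ennreal ((heat_kernel nu s y)\<^sup>2) * g (1 - s) (0 - y)"
          using kernel[of s y] s d2 d2pos True by (intro mult_mono ennreal_leI) auto
        then show ?thesis
          using True kl by (simp add: ennreal_mult)
      qed simp
    qed
    finally show ?thesis .
  qed
  have "lam\<^sup>2 * exp (- (6 / nu)) / (32 * pi\<^sup>2 * nu ^ 4) / d = k * (lam\<^sup>2 * l) * d * d\<^sup>2"
  proof -
    have "exp (- (6 / nu)) = exp (- (2 / nu)) * exp (- (4 / nu))"
      by (simp flip: exp_add)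
    then show ?thesis
      unfolding k_def l_def using nu d by (simp add: field_simps eval_nat_numeral)
  qed
  then have "ennreal (lam\<^sup>2 * exp (- (6 / nu)) / (32 * pi\<^sup>2 * nu ^ 4) / d)
      = (\<integral>\<^sup>+s. ennreal (k * (lam\<^sup>2 * l) * d) * indicator {1 - 2 * d\<^sup>2..1 - d\<^sup>2} s \<partial>lborel)"
    using kl d by (simp add: nn_integral_cmult_indicator ennreal_mult)
  also have "\<dots> \<le> spacetime_conv (\<lambda>s y. ennreal ((heat_kernel nu s y)\<^sup>2)) g 1 0"
    unfolding spacetime_conv_def
  proof (rule nn_integral_mono)
    fix s
    show "ennreal (k * (lam\<^sup>2 * l) * d) * indicator {1 - 2 * d\<^sup>2..1 - d\<^sup>2} s
        \<le> (\<integral>\<^sup>+y. ennreal ((heat_kernel nu s y)\<^sup>2) * g (1 - s) (0 - y) \<partial>lborel) * indicator {0..1} s"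
    proof (cases "s \<in> {1 - 2 * d\<^sup>2..1 - d\<^sup>2}")
      case True
      then have "s \<in> {0..1}"
        using d2 d2pos by auto
      then show ?thesis
        using True inner[of s] by simp
    qed simp
  qed
  finally show ?thesis .
qed

text \<open>The lower bound of order \<open>1 / d\<close> holds for arbitrarily small \<open>d\<close>.\<close>

lemma spacetime_conv_J0_deriv_dirac_infinite:
  fixes nu lam :: real
  assumes nu: "nu > 0" and lam: "lam \<noteq> 0"
    and g: "\<And>s y. s > 0 \<Longrightarrow> g s y \<ge> ennreal ((lam * J0 nu (distr_deriv dirac) s y)\<^sup>2)"
  shows "spacetime_conv (\<lambda>s y. ennreal ((heat_kernel nu s y)\<^sup>2)) g 1 0 = \<infinity>"
proof -
  define K where "K = lam\<^sup>2 * exp (- (6 / nu)) / (32 * pi\<^sup>2 * nu ^ 4)"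
  have K: "K > 0"
    using nu lam by (simp add: K_def)
  let ?c = "spacetime_conv (\<lambda>s y. ennreal ((heat_kernel nu s y)\<^sup>2)) g 1 0"
  have "ennreal x \<le> ?c" for x
  proof -
    define d where "d = min (1 / 2) (K / (\<bar>x\<bar> + 1))"
    have d: "0 < d" "d \<le> 1 / 2" "d \<le> K / (\<bar>x\<bar> + 1)"
      using K unfolding d_def by (simp_all only: min.cobounded1 min.cobounded2 min_less_iff_conj) auto
    have "d * x \<le> d * (\<bar>x\<bar> + 1)"
      using d by (intro mult_left_mono) auto
    also have "\<dots> \<le> K"
      using d(3) by (simp add: field_simps)
    finally have "x \<le> K / d"
      using d K by (simp add: field_simps)
    then have "ennreal x \<le> ennreal (K / d)"
      by (rule ennreal_leI)
    also have "\<dots> \<le> ?c"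
      unfolding K_def using nu d(1,2) g by (rule spacetime_conv_J0_deriv_dirac_ge)
    finally show ?thesis .
  qed
  then have "of_nat n \<le> ?c" for n
    by (metis ennreal_of_nat_eq_real_of_nat)
  then show ?thesis
    by (metis ennreal_Ex_less_of_nat infinity_ennreal_def leD top.not_eq_extremum)
qed

section \<open>Nonexistence\<close>

theorem proposition2p9:
  fixes nu lam :: real
    and M :: "'w measure"
    and W :: "(real \<times> real) set \<Rightarrow> 'w \<Rightarrow> real"
  assumes "nu > 0" and "lam \<noteq> 0"
    and "prob_space M"
    and "space_time_white_noise M W"
  shows "\<not> (\<exists>u. random_field_solution M W nu (\<lambda>z. lam * z) (distr_deriv dirac) u)"
proof
  assume "\<exists>u. random_field_solution M W nu (\<lambda>z. lam * z) (distr_deriv dirac) u"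
  then obtain u where u: "random_field_solution M W nu (\<lambda>z. lam * z) (distr_deriv dirac) u" ..
  interpret white_noise M W
    using assms(3,4) by (intro white_noise.intro white_noise_axioms.intro)
  let ?J = "J0 nu (distr_deriv dirac)"
  let ?g = "\<lambda>s y. L2norm_sq M (\<lambda>w. lam * u s y w)"
  note sol = u[unfolded random_field_solution_def]
  have finite: "\<forall>t>0. \<forall>x. spacetime_conv (\<lambda>s y. ennreal ((heat_kernel nu s y)\<^sup>2)) ?g t x < \<infinity>"
    using sol by (elim conjE)
  obtain I where walsh: "\<forall>t>0. \<forall>x. has_walsh_integral M W
        (\<lambda>s y w. indicator {0..t} s * heat_kernel nu (t - s) (x - y) * (lam * u s y w)) (I t x)"
    and I2: "\<forall>t>0. \<forall>x. L2norm_sq M (I t x) < \<infinity>"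
    and mild: "\<forall>t>0. \<forall>x. AE w in M. u t x w = ?J t x + I t x w"
    using sol by (elim exE conjE) (rule that; assumption)
  have "ennreal ((lam * ?J s y)\<^sup>2) \<le> ?g s y" if s: "s > 0" for s y
  proof -
    note I = expectation_walsh_integral[OF walsh[rule_format, OF s] I2[rule_format, OF s], of y]
    have int: "integrable M (\<lambda>w. lam * (?J s y + I s y w))"
      using I(1) by simp
    have mean: "expectation (\<lambda>w. lam * (?J s y + I s y w)) = lam * ?J s y"
      using I by (simp add: prob_space)
    have "ennreal ((lam * ?J s y)\<^sup>2) \<le> L2norm_sq M (\<lambda>w. lam * (?J s y + I s y w))"
      using square_expectation_le_L2norm_sq[OF int] unfolding mean .
    also have "\<dots> = ?g s y"
      unfolding L2norm_sq_def
    proof (rule nn_integral_cong_AE)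
      show "AE w in M. ennreal ((lam * (?J s y + I s y w))\<^sup>2) = ennreal ((lam * u s y w)\<^sup>2)"
        using mild[rule_format, OF s, of y] by eventually_elim simp
    qed
    finally show ?thesis .
  qed
  then have "spacetime_conv (\<lambda>s y. ennreal ((heat_kernel nu s y)\<^sup>2)) ?g 1 0 = \<infinity>"
    using assms(1,2) by (intro spacetime_conv_J0_deriv_dirac_infinite)
  then show False
    using finite[rule_format, of 1 0] by simp
qed

end
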